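(* The bottleneck distance between persistence diagrams computed with the power complex filtration is not bounded above by a constant times the distance $D^U$ between the graphs. That is, there is no real constant $\alpha$ such that, for every finite nonempty set $V$, all unweighted undirected graphs $G_1=(V,E_1)$ and $G_2=(V,E_2)$ on $V$, and every integer $p\ge 0$, one has $B(P_1,P_2)\le \alpha\, D^U(G_1,G_2)$, where $P_1$ and $P_2$ are the $p$-dimensional persistence diagrams of the power complex filtrations of $G_1$ and $G_2$ respectively.
   Context: Graphs are finite, simple, undirected and unweighted. For two graphs on the same vertex set $V$, $D^U((V,E_1),(V,E_2))=\max_{i,j\in V}|\mathbb{1}_{E_1}((i,j))-\mathbb{1}_{E_2}((i,j))|\in\{0,1\}$, where $\mathbb{1}_E$ is the indicator function of the edge set $E$. The clique complex of a graph is the abstract simplicial complex whose $(k-1)$-simplices are the cliques of size $k$ ($k\ge1$). The $i$-th power $G^i$ of $G$ is the graph with the same vertex set as $G$ and an edge between two distinct vertices if and only if there is a path of length (number of edges) at most $i$ between them in $G$. The power complex filtration of $G$ is $\emptyset\subset K_0\subset K_1\subset\dots\subset K_d$, where $K_i$ is the clique complex of $G^i$ (so $K_0$ consists of the vertices only) and $d$ is the diameter of $G$ (the greatest finite distance between two vertices if $G$ is disconnected). Equivalently, it is the Vietoris–Rips filtration of $V$ with the shortest-path distance of $G$, vertices in different components being at infinite distance. Persistent homology is simplicial homology (unreduced) with coefficients in a fixed field. The $p$-dimensional persistence diagram of a filtration is the multiset of pairs $(i,j)$, one for each $p$-dimensional persistent homology class born at $K_i$ and dying at $K_j$ (with filtration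 indices as coordinates); a class that never dies has $j=\infty$. The bottleneck distance is $B(X,Y)=\inf_{\eta}\sup_{x\in X}\|x-\eta(x)\|_\infty$, where all diagonal points $(a,a)$ with infinite multiplicity are first added to both diagrams and $\eta$ ranges over bijections $X\to Y$; by convention $|\infty-\infty|=0$ and $|\infty-a|=\infty$ for finite $a$. Thus $B$ takes values in $[0,\infty]$. *)

theory Defs
  imports Complex_Main "HOL-Library.Function_Algebras" "HOL-Library.Indicator_Function"
    "HOL-Library.Multiset" "HOL-Library.Extended_Real"
begin

section \<open>Graphs\<close>

text \<open>An edge set is a symmetric, irreflexive set of ordered pairs.\<close>

definition simple_graph :: "'v set \<Rightarrow> ('v \<times> 'v) set \<Rightarrow> bool" where
  "simple_graph V E \<longleftrightarrow> finite V \<and> E \<subseteq> V \<times> V \<and> sym E \<and> irrefl E"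

definition graph_distance :: "'v set \<Rightarrow> ('v \<times> 'v) set \<Rightarrow> ('v \<times> 'v) set \<Rightarrow> real" where
  "graph_distance V E1 E2 = Max ((\<lambda>e. \<bar>indicator E1 e - indicator E2 e\<bar>) ` (V \<times> V))"

text \<open>A path is given by the list of its vertices, so it has \<open>length xs - 1\<close> edges.\<close>

definition path_between :: "('v \<times> 'v) set \<Rightarrow> 'v \<Rightarrow> 'v list \<Rightarrow> 'v \<Rightarrow> bool" where
  "path_between E x xs y \<longleftrightarrow> xs \<noteq> [] \<and> hd xs = x \<and> last xs = y \<and> distinct xs \<and>
     successively (\<lambda>u v. (u, v) \<in> E) xs"

definition shortest_path_dist :: "('v \<times> 'v) set \<Rightarrow> 'v \<Rightarrow> 'v \<Rightarrow> nat" where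
  "shortest_path_dist E x y = (LEAST n. \<exists>xs. path_between E x xs y \<and> length xs - 1 = n)"

definition diameter :: "'v set \<Rightarrow> ('v \<times> 'v) set \<Rightarrow> nat" where
  "diameter V E = Max {shortest_path_dist E x y | x y.
     x \<in> V \<and> y \<in> V \<and> (\<exists>xs. path_between E x xs y)}"

definition graph_power :: "'v set \<Rightarrow> ('v \<times> 'v) set \<Rightarrow> nat \<Rightarrow> ('v \<times> 'v) set" where
  "graph_power V E i = {(x, y). x \<in> V \<and> y \<in> V \<and> x \<noteq> y \<and>
     (\<exists>xs. path_between E x xs y \<and> length xs - 1 \<le> i)}"

text \<open>Abstract simplicial complexes are represented by their sets of nonempty simplices.\<close>

definition clique_complex :: "'v set \<Rightarrow> ('v \<times> 'v) set \<Rightarrow> 'v set set" where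
  "clique_complex V E = {\<sigma>. \<sigma> \<subseteq> V \<and> finite \<sigma> \<and> \<sigma> \<noteq> {} \<and>
     (\<forall>x\<in>\<sigma>. \<forall>y\<in>\<sigma>. x \<noteq> y \<longrightarrow> (x, y) \<in> E)}"

definition power_complex :: "'v set \<Rightarrow> ('v \<times> 'v) set \<Rightarrow> nat \<Rightarrow> 'v set set" where
  "power_complex V E i = clique_complex V (graph_power V E i)"

section \<open>Simplicial homology over a field\<close>

text \<open>A chain is a coefficient function on simplices; simplices are oriented by the order
  of the vertices.\<close>

definition scale_chain :: "'k::field \<Rightarrow> ('v set \<Rightarrow> 'k) \<Rightarrow> 'v set \<Rightarrow> 'k" where
  "scale_chain a c = (\<lambda>\<sigma>. a * c \<sigma>)"

global_interpretation chain: vector_space "scale_chain :: 'k::field \<Rightarrow> ('v set \<Rightarrow> 'k) \<Rightarrow> 'v set \<Rightarrow> 'k"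
  by unfold_locales (auto simp: scale_chain_def fun_eq_iff algebra_simps)

definition chains :: "nat \<Rightarrow> 'v set set \<Rightarrow> ('v set \<Rightarrow> 'k::field) set" where
  "chains p K = {c. \<forall>\<sigma>. c \<sigma> \<noteq> 0 \<longrightarrow> \<sigma> \<in> K \<and> card \<sigma> = Suc p}"

text \<open>The boundary of \<open>\<sigma> = {v\<^sub>0 < \<dots> < v\<^sub>p}\<close> is the alternating sum of the faces
  \<open>\<sigma> - {v\<^sub>i}\<close>. The empty face gets coefficient 0, as homology is unreduced.\<close>

definition boundary :: "('v::linorder set \<Rightarrow> 'k::field) \<Rightarrow> 'v set \<Rightarrow> 'k" where
  "boundary c = (\<lambda>\<tau>. if \<tau> = {} then 0 else
     (\<Sum>\<sigma> | c \<sigma> \<noteq> 0. \<Sum>v \<in> \<sigma>. if \<sigma> - {v} = \<tau> then (-1) ^ card {u \<in> \<sigma>. u < v} * c \<sigma> else 0))"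

definition cycles :: "nat \<Rightarrow> 'v::linorder set set \<Rightarrow> ('v set \<Rightarrow> 'k::field) set" where
  "cycles p K = {c \<in> chains p K. boundary c = 0}"

definition boundaries :: "nat \<Rightarrow> 'v::linorder set set \<Rightarrow> ('v set \<Rightarrow> 'k::field) set" where
  "boundaries p K = boundary ` chains (Suc p) K"

text \<open>The dimension of \<open>U / W\<close>, for subspaces \<open>W \<subseteq> U\<close> of finite dimension.\<close>

definition quotient_dim :: "('v set \<Rightarrow> 'k::field) set \<Rightarrow> ('v set \<Rightarrow> 'k) set \<Rightarrow> nat" where
  "quotient_dim U W = chain.dim U - chain.dim W"

text \<open>For \<open>K \<subseteq> L\<close>, the image of \<open>H\<^sub>p(K) \<rightarrow> H\<^sub>p(L)\<close> is the persistent homology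
  group \<open>Z\<^sub>p(K) / (Z\<^sub>p(K) \<inter> B\<^sub>p(L))\<close>; this is its dimension.\<close>

definition persistent_betti ::
    "'k::field itself \<Rightarrow> nat \<Rightarrow> 'v::linorder set set \<Rightarrow> 'v set set \<Rightarrow> nat" where
  "persistent_betti _ p K L =
     quotient_dim (cycles p K :: ('v set \<Rightarrow> 'k) set) (cycles p K \<inter> boundaries p L)"

section \<open>Persistence diagrams\<close>

text \<open>A filtration is \<open>{} \<subseteq> K 0 \<subseteq> \<dots> \<subseteq> K d\<close>. Below, \<open>pred_complex K i\<close> is the complex
  preceding \<open>K i\<close>.\<close>

definition pred_complex :: "(nat \<Rightarrow> 'v set set) \<Rightarrow> nat \<Rightarrow> 'v set set" where
  "pred_complex K i = (case i of 0 \<Rightarrow> {} | Suc l \<Rightarrow> K l)"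

text \<open>The number of independent classes born at \<open>K i\<close> and dying at \<open>K j\<close>, for \<open>i < j\<close>: those
  whose image is alive in \<open>K (j - 1)\<close> but no longer in \<open>K j\<close>, minus the ones among them that
  were already present before \<open>K i\<close>. All the differences are nonnegative, so truncated
  subtraction is harmless here.\<close>

definition finite_multiplicity ::
    "'k::field itself \<Rightarrow> nat \<Rightarrow> (nat \<Rightarrow> 'v::linorder set set) \<Rightarrow> nat \<Rightarrow> nat \<Rightarrow> nat" where
  "finite_multiplicity k p K i j =
     (persistent_betti k p (K i) (K (j - 1)) - persistent_betti k p (K i) (K j)) -
     (persistent_betti k p (pred_complex K i) (K (j - 1)) -
      persistent_betti k p (pred_complex K i) (K j))"

definition infinite_multiplicity ::
    "'k::field itself \<Rightarrow> nat \<Rightarrow> (nat \<Rightarrow> 'v::linorder set set) \<Rightarrow> nat \<Rightarrow> nat \<Rightarrow> nat" where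
  "infinite_multiplicity k p K d i =
     persistent_betti k p (K i) (K d) - persistent_betti k p (pred_complex K i) (K d)"

definition persistence_diagram ::
    "'k::field itself \<Rightarrow> nat \<Rightarrow> (nat \<Rightarrow> 'v::linorder set set) \<Rightarrow> nat \<Rightarrow> (ereal \<times> ereal) multiset" where
  "persistence_diagram k p K d =
     (\<Sum>i\<in>{0..d}.
        (\<Sum>j\<in>{i<..d}. replicate_mset (finite_multiplicity k p K i j) (ereal (real i), ereal (real j)))
        + replicate_mset (infinite_multiplicity k p K d i) (ereal (real i), \<infinity>))"

definition power_complex_diagram ::
    "'k::field itself \<Rightarrow> nat \<Rightarrow> 'v::linorder set \<Rightarrow> ('v \<times> 'v) set \<Rightarrow> (ereal \<times> ereal) multiset" where
  "power_complex_diagram k p V E = persistence_diagram k p (power_complex V E) (diameter V E)"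

section \<open>Bottleneck distance\<close>

text \<open>The equality test is needed since \<open>\<infinity> - \<infinity> = \<infinity>\<close> in \<open>ereal\<close>.\<close>

definition coord_dist :: "ereal \<Rightarrow> ereal \<Rightarrow> ereal" where
  "coord_dist a b = (if a = b then 0 else \<bar>a - b\<bar>)"

definition point_dist :: "ereal \<times> ereal \<Rightarrow> ereal \<times> ereal \<Rightarrow> ereal" where
  "point_dist x y = max (coord_dist (fst x) (fst y)) (coord_dist (snd x) (snd y))"

text \<open>The points of a diagram with their multiplicities, the copies of a point being
  distinguished by a natural number, together with infinitely many copies of every diagonal
  point.\<close>

definition with_diagonal :: "(ereal \<times> ereal) multiset \<Rightarrow> ((ereal \<times> ereal) \<times> nat) set" where
  "with_diagonal X = {(x, n). n < count X x} \<union> {((ereal a, ereal a), n) | a n. True}"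

definition bottleneck_distance ::
    "(ereal \<times> ereal) multiset \<Rightarrow> (ereal \<times> ereal) multiset \<Rightarrow> ereal" where
  "bottleneck_distance X Y =
     (INF \<eta> \<in> {\<eta>. bij_betw \<eta> (with_diagonal X) (with_diagonal Y)}.
        SUP x \<in> with_diagonal X. point_dist (fst x) (fst (\<eta> x)))"

end

theory Submission
  imports Defs
begin

text \<open>The bottleneck distance can be infinite, whereas \<open>graph_distance\<close> is always a real number,
  so a single pair of graphs refutes every constant at once. A class that never dies is
  infinitely far from every point with finite death time, the diagonal included; hence a diagram
  is at distance \<open>\<infinity>\<close> from any diagram with fewer such essential classes
  (\<open>bottleneck_distance_infinite\<close>). In dimension 0 the essential classes are the connected
  components, so it suffices to add one edge that joins two components. The smallest instance
  is the graph on two vertices without an edge, whose diagram is twice \<open>(0, \<infinity>)\<close>, against the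
  graph on two vertices with an edge, whose only essential class is one \<open>(0, \<infinity>)\<close>.

  The homology needed for this is that of 0-chains: all of them are cycles, their dimension is
  the number of vertices, and the boundaries vanish without edges (\<open>essential_classes_no_edges\<close>) and form a
  line when there is exactly one edge (\<open>boundaries_edge\<close>, \<open>essential_classes_edge\<close>).\<close>

section \<open>Essential classes and the bottleneck distance\<close>

definition essential_part :: "(ereal \<times> ereal) multiset \<Rightarrow> (ereal \<times> ereal) multiset" where
  "essential_part X = {#x \<in># X. snd x = \<infinity>#}"

lemma essential_copies_eq_Sigma:
  "{z \<in> with_diagonal X. snd (fst z) = \<infinity>} =
     (SIGMA x:set_mset (essential_part X). {..<count (essential_part X) x})"
  by (auto simp: with_diagonal_def essential_part_def simp flip: count_greater_zero_iff)

lemma finite_essential_copies: "finite {z \<in> with_diagonal X. snd (fst z) = \<infinity>}"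
  unfolding essential_copies_eq_Sigma by auto

lemma card_essential_copies:
  "card {z \<in> with_diagonal X. snd (fst z) = \<infinity>} = size (essential_part X)"
  unfolding essential_copies_eq_Sigma by (simp add: size_multiset_overloaded_eq)

lemma point_dist_essential:
  assumes "snd x = \<infinity>" "snd y \<noteq> \<infinity>"
  shows "point_dist x y = \<infinity>"
  using assms by (cases "snd y") (auto simp: point_dist_def coord_dist_def)

text \<open>By the pigeonhole principle every matching must send some essential point to a point with
  finite death time.\<close>

lemma bottleneck_distance_infinite:
  assumes "size (essential_part Y) < size (essential_part X)"
  shows "bottleneck_distance X Y = \<infinity>"
proof -
  have "(SUP x \<in> with_diagonal X. point_dist (fst x) (fst (\<eta> x))) = \<infinity>"
    if bij: "bij_betw \<eta> (with_diagonal X) (with_diagonal Y)" for \<eta>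
  proof -
    let ?X = "{z \<in> with_diagonal X. snd (fst z) = \<infinity>}"
    let ?Y = "{z \<in> with_diagonal Y. snd (fst z) = \<infinity>}"
    have "inj_on \<eta> ?X"
      using bij by (auto simp: bij_betw_def inj_on_def)
    hence "\<not> \<eta> ` ?X \<subseteq> ?Y"
      using card_inj_on_le[of \<eta> ?X ?Y] finite_essential_copies[of Y] assms
      by (auto simp: card_essential_copies)
    then obtain z where z: "z \<in> ?X" "\<eta> z \<notin> ?Y" by blast
    moreover have "\<eta> z \<in> with_diagonal Y"
      using bij z by (auto simp: bij_betw_def)
    ultimately have "point_dist (fst z) (fst (\<eta> z)) = \<infinity>"
      by (intro point_dist_essential) auto
    moreover have "point_dist (fst z) (fst (\<eta> z)) \<le>
        (SUP x \<in> with_diagonal X. point_dist (fst x) (fst (\<eta> x)))"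
      using z by (intro SUP_upper) auto
    ultimately show ?thesis by simp
  qed
  thus ?thesis
    unfolding bottleneck_distance_def by (auto intro!: INF_eqI simp: top_ereal_def)
qed

lemma size_essential_part_persistence_diagram:
  "size (essential_part (persistence_diagram k p K d)) =
     (\<Sum>i\<in>{0..d}. infinite_multiplicity k p K d i)"
proof -
  have filter_sum: "essential_part (sum f A) = (\<Sum>a\<in>A. essential_part (f a))"
    if "finite A" for f :: "nat \<Rightarrow> (ereal \<times> ereal) multiset" and A
    using that by induction (auto simp: essential_part_def)
  have "essential_part (replicate_mset n (a, ereal b)) = {#}"
    "essential_part (replicate_mset n (a, \<infinity>)) = replicate_mset n (a, \<infinity>)"
    "essential_part (A + B) = essential_part A + essential_part B" for n a b A B
    by (auto simp: essential_part_def filter_mset_eq_conv)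
  thus ?thesis
    by (simp add: persistence_diagram_def filter_sum size_multiset_sum)
qed

section \<open>Chains and boundaries in dimension 0\<close>

definition elementary_chain :: "'v set \<Rightarrow> 'v set \<Rightarrow> 'k::field" where
  "elementary_chain \<sigma> = (\<lambda>\<tau>. if \<tau> = \<sigma> then 1 else 0)"

lemma sum_elementary_chains:
  assumes "finite S"
  shows "(\<Sum>\<sigma>\<in>S. scale_chain (a \<sigma>) (elementary_chain \<sigma>)) \<tau> = (if \<tau> \<in> S then a \<tau> else 0)"
  using assms by (induction S) (auto simp: scale_chain_def elementary_chain_def)

lemma inj_elementary_chain: "inj (elementary_chain :: 'v set \<Rightarrow> 'v set \<Rightarrow> 'k::field)"
  by (rule injI) (metis elementary_chain_def zero_neq_one)

lemma independent_elementary_chains: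
  assumes "finite S"
  shows "chain.independent (elementary_chain ` S :: ('v set \<Rightarrow> 'k::field) set)"
proof (rule chain.independent_if_scalars_zero)
  fix f :: "('v set \<Rightarrow> 'k) \<Rightarrow> 'k" and c :: "'v set \<Rightarrow> 'k"
  assume eq: "(\<Sum>x\<in>elementary_chain ` S. scale_chain (f x) x) = 0"
    and c: "c \<in> elementary_chain ` S"
  have "(\<Sum>\<sigma>\<in>S. scale_chain (f (elementary_chain \<sigma>)) (elementary_chain \<sigma>)) = 0"
    using eq by (simp add: sum.reindex inj_on_subset[OF inj_elementary_chain])
  hence "(if \<tau> \<in> S then f (elementary_chain \<tau>) else 0) = 0" for \<tau>
    using sum_elementary_chains[OF assms, of "\<lambda>\<sigma>. f (elementary_chain \<sigma>)" \<tau>] by simp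
  thus "f c = 0" using c by (metis imageE)
qed (use assms in auto)

lemma dim_chains:
  assumes "finite {\<sigma>\<in>K. card \<sigma> = Suc p}"
  shows "chain.dim (chains p K :: ('v set \<Rightarrow> 'k::field) set) = card {\<sigma>\<in>K. card \<sigma> = Suc p}"
proof -
  let ?S = "{\<sigma>\<in>K. card \<sigma> = Suc p}"
  let ?B = "elementary_chain ` ?S :: ('v set \<Rightarrow> 'k) set"
  have "c \<in> chain.span ?B" if "c \<in> chains p K" for c
  proof -
    have "c \<tau> = (\<Sum>\<sigma>\<in>?S. scale_chain (c \<sigma>) (elementary_chain \<sigma>)) \<tau>" for \<tau>
      unfolding sum_elementary_chains[OF assms] using that by (auto simp: chains_def)
    hence "c = (\<Sum>\<sigma>\<in>?S. scale_chain (c \<sigma>) (elementary_chain \<sigma>))" by blast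
    also have "\<dots> \<in> chain.span ?B"
      by (intro chain.span_sum chain.span_scale chain.span_base) auto
    finally show ?thesis .
  qed
  moreover have "?B \<subseteq> chains p K"
    by (auto simp: chains_def elementary_chain_def split: if_splits)
  moreover have "card ?B = card ?S"
    by (intro card_image inj_on_subset[OF inj_elementary_chain]) simp
  ultimately show ?thesis
    using chain.dim_unique[of ?B "chains p K" "card ?S"] independent_elementary_chains[OF assms]
    by blast
qed

text \<open>The only face of a vertex is the empty one, which unreduced homology ignores.\<close>

lemma cycles_0: "cycles 0 K = (chains 0 K :: ('v::linorder set \<Rightarrow> 'k::field) set)"
proof -
  have "boundary c \<tau> = 0" if c: "c \<in> chains 0 K" for c :: "'v set \<Rightarrow> 'k" and \<tau>
  proof (cases "\<tau> = {}")
    case False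
    have "(\<Sum>v\<in>\<sigma>. if \<sigma> - {v} = \<tau> then (-1) ^ card {u \<in> \<sigma>. u < v} * c \<sigma> else 0) = 0"
      if "c \<sigma> \<noteq> 0" for \<sigma>
    proof -
      obtain w where "\<sigma> = {w}"
        using c \<open>c \<sigma> \<noteq> 0\<close> by (auto simp: chains_def card_1_singleton_iff)
      thus ?thesis using False by simp
    qed
    thus ?thesis by (simp add: boundary_def)
  qed (simp add: boundary_def)
  thus ?thesis by (auto simp: cycles_def fun_eq_iff)
qed

lemma boundary_edge:
  fixes u v :: "'v::linorder"
  assumes "u < v"
  shows "boundary (scale_chain a (elementary_chain {u, v})) =
    scale_chain (a :: 'k::field) (elementary_chain {v} - elementary_chain {u})"
proof (cases "a = 0")
  case True
  thus ?thesis by (auto simp: boundary_def scale_chain_def fun_eq_iff)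
next
  case False
  have supp: "{\<sigma>. scale_chain a (elementary_chain {u, v}) \<sigma> \<noteq> 0} = {{u, v}}"
    using False by (auto simp: scale_chain_def elementary_chain_def split: if_splits)
  have faces: "{u, v} - {u} = {v}" "{u, v} - {v} = {u}"
    and signs: "{w. (w = u \<or> w = v) \<and> w < u} = {}" "{w. (w = u \<or> w = v) \<and> w < v} = {u}"
    using assms by auto
  have sum_ends: "sum f {u, v} = f u + f v" for f :: "'v \<Rightarrow> 'k"
    using assms by simp
  show ?thesis
    unfolding boundary_def supp using assms
    by (auto simp: sum_ends faces signs scale_chain_def elementary_chain_def fun_eq_iff)
qed

section \<open>The two graphs on two vertices\<close>

lemma power_complex_0: "power_complex V E 0 = (\<lambda>v. {v}) ` V"
proof -
  have "graph_power V E 0 = {}"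
    by (auto simp: graph_power_def path_between_def le_Suc_eq length_Suc_conv)
  hence "power_complex V E 0 = {\<sigma>. \<sigma> \<subseteq> V \<and> \<sigma> \<noteq> {} \<and> finite \<sigma> \<and> (\<forall>x\<in>\<sigma>. \<forall>y\<in>\<sigma>. x = y)}"
    unfolding power_complex_def clique_complex_def by blast
  also have "\<dots> = (\<lambda>v. {v}) ` V"
  proof (intro set_eqI iffI)
    fix \<sigma>
    assume \<sigma>: "\<sigma> \<in> {\<sigma>. \<sigma> \<subseteq> V \<and> \<sigma> \<noteq> {} \<and> finite \<sigma> \<and> (\<forall>x\<in>\<sigma>. \<forall>y\<in>\<sigma>. x = y)}"
    then obtain v where "v \<in> \<sigma>" by blast
    hence "\<sigma> = {v}" using \<sigma> by blast
    thus "\<sigma> \<in> (\<lambda>v. {v}) ` V" using \<sigma> by blast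
  qed auto
  finally show ?thesis .
qed

text \<open>Whatever edges are added, the vertex set stays the same, so no 0-dimensional class is born
  after the start.\<close>

lemma chains_0_power_complex: "chains 0 (power_complex V E i) = chains 0 ((\<lambda>v. {v}) ` V)"
  by (auto simp: chains_def power_complex_def clique_complex_def card_1_singleton_iff)

lemma dim_chains_0_power_complex:
  assumes "finite V"
  shows "chain.dim (chains 0 (power_complex V E i) :: ('v set \<Rightarrow> 'k::field) set) = card V"
proof -
  have "{\<sigma> \<in> (\<lambda>v. {v}) ` V. card \<sigma> = Suc 0} = (\<lambda>v. {v}) ` V" by auto
  thus ?thesis
    using assms dim_chains[of "(\<lambda>v. {v}) ` V" 0]
    by (simp add: chains_0_power_complex card_image)
qed

lemma persistent_betti_empty: "persistent_betti k 0 {} L = 0"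
  by (simp add: persistent_betti_def quotient_dim_def cycles_0 dim_chains)

text \<open>The diameter fixes the last complex of the filtration, in which the essential classes are
  counted.\<close>

lemma diameter_no_edges:
  assumes "V \<noteq> {}"
  shows "diameter V {} = 0"
proof -
  have path: "path_between {} x xs y \<longleftrightarrow> x = y \<and> xs = [x]" for x y :: 'a and xs
    by (cases xs rule: remdups_adj.cases) (auto simp: path_between_def)
  hence "{shortest_path_dist {} x y | x y. x \<in> V \<and> y \<in> V \<and> (\<exists>xs. path_between {} x xs y)} = {0}"
    using assms by (auto simp: shortest_path_dist_def)
  thus ?thesis by (simp add: diameter_def)
qed

lemma essential_classes_no_edges:
  fixes V :: "'v::linorder set"
  assumes "finite V" "V \<noteq> {}"
  shows "size (essential_part (power_complex_diagram TYPE('k::field) 0 V {})) = card V"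
proof -
  have "chains (Suc 0) (power_complex V {} 0) = {0 :: 'v set \<Rightarrow> 'k}"
    by (fastforce simp: chains_def power_complex_0 fun_eq_iff)
  hence "boundaries 0 (power_complex V {} 0) = {0 :: 'v set \<Rightarrow> 'k}"
    by (simp add: boundaries_def boundary_def fun_eq_iff)
  hence "chain.dim (cycles 0 (power_complex V {} 0) \<inter> boundaries 0 (power_complex V {} 0)
      :: ('v set \<Rightarrow> 'k) set) = 0"
    using chain.dim_le_card[of _ "{} :: ('v set \<Rightarrow> 'k) set"] by simp
  hence "persistent_betti TYPE('k) 0 (power_complex V {} 0) (power_complex V {} 0) = card V"
    by (simp add: persistent_betti_def quotient_dim_def cycles_0 dim_chains_0_power_complex assms)
  thus ?thesis
    by (simp add: power_complex_diagram_def diameter_no_edges assms infinite_multiplicity_def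
      size_essential_part_persistence_diagram pred_complex_def persistent_betti_empty)
qed

definition edge_between :: "'v \<Rightarrow> 'v \<Rightarrow> ('v \<times> 'v) set" where
  "edge_between u v = {(u, v), (v, u)}"

lemma diameter_edge:
  assumes "u \<noteq> v"
  shows "diameter {u, v} (edge_between u v) = 1"
proof -
  let ?E = "edge_between u v"
  have self: "path_between ?E x [x] x" for x
    by (simp add: path_between_def)
  hence dist_self: "shortest_path_dist ?E x x = 0" for x
    unfolding shortest_path_dist_def by (intro Least_equality exI[of _ "[x]"]) auto
  have edge: "path_between ?E x [x, y] y" if "(x, y) \<in> ?E" for x y
    using that assms by (auto simp: path_between_def edge_between_def)
  have dist_edge: "shortest_path_dist ?E x y = 1" if xy: "(x, y) \<in> ?E" for x y
    unfolding shortest_path_dist_def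
  proof (rule Least_equality)
    show "\<exists>xs. path_between ?E x xs y \<and> length xs - 1 = 1"
      using edge[OF xy] by (intro exI[of _ "[x, y]"]) auto
  next
    fix n
    assume "\<exists>xs. path_between ?E x xs y \<and> length xs - 1 = n"
    then obtain xs where xs: "path_between ?E x xs y" "length xs - 1 = n" by blast
    have "x \<noteq> y" using xy assms by (auto simp: edge_between_def)
    with xs(1) have "length xs \<noteq> 1" "xs \<noteq> []"
      by (auto simp: path_between_def length_Suc_conv)
    thus "1 \<le> n" using xs(2) by (cases xs) (auto simp: Suc_le_eq)
  qed
  have "{shortest_path_dist ?E x y | x y. x \<in> {u, v} \<and> y \<in> {u, v} \<and>
      (\<exists>xs. path_between ?E x xs y)} = {0, 1}" (is "?D = _")
  proof
    show "?D \<subseteq> {0, 1}"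
      using dist_self dist_edge[of u v] dist_edge[of v u] by (auto simp: edge_between_def)
    have "0 \<in> ?D" using self[of u] dist_self[of u, symmetric] by blast
    moreover have "1 \<in> ?D"
      using edge[of u v] dist_edge[of u v, symmetric] by (auto simp: edge_between_def)
    ultimately show "{0, 1} \<subseteq> ?D" by simp
  qed
  thus ?thesis by (simp add: diameter_def)
qed

lemma edge_in_power_complex:
  assumes "u \<noteq> v"
  shows "{u, v} \<in> power_complex {u, v} (edge_between u v) 1"
proof -
  have "path_between (edge_between u v) u [u, v] v" "path_between (edge_between u v) v [v, u] u"
    using assms by (auto simp: path_between_def edge_between_def)
  hence "(u, v) \<in> graph_power {u, v} (edge_between u v) 1"
    "(v, u) \<in> graph_power {u, v} (edge_between u v) 1"
    using assms unfolding graph_power_def by force+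
  thus ?thesis by (auto simp: power_complex_def clique_complex_def)
qed

lemma boundaries_edge:
  fixes u v :: "'v::linorder"
  assumes "u < v"
  shows "boundaries 0 (power_complex {u, v} (edge_between u v) 1) =
    chain.span {elementary_chain {v} - elementary_chain {u} :: 'v set \<Rightarrow> 'k::field}"
proof -
  let ?K = "power_complex {u, v} (edge_between u v) 1"
  have uv: "\<sigma> = {u, v}" if "\<sigma> \<in> ?K" "card \<sigma> = Suc (Suc 0)" for \<sigma>
    using that assms card_subset_eq[of "{u, v}" \<sigma>]
    by (auto simp: power_complex_def clique_complex_def)
  have K: "{u, v} \<in> ?K" "card {u, v} = Suc (Suc 0)"
    using edge_in_power_complex[of u v] assms by auto
  have "chains (Suc 0) ?K = range (\<lambda>a :: 'k. scale_chain a (elementary_chain {u, v}))"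
  proof (intro set_eqI iffI)
    fix c :: "'v set \<Rightarrow> 'k"
    assume "c \<in> chains (Suc 0) ?K"
    hence "c \<sigma> = 0" if "\<sigma> \<noteq> {u, v}" for \<sigma>
      using uv that by (auto simp: chains_def)
    hence "c = scale_chain (c {u, v}) (elementary_chain {u, v})"
      by (auto simp: scale_chain_def elementary_chain_def fun_eq_iff)
    thus "c \<in> range (\<lambda>a. scale_chain a (elementary_chain {u, v}))" by blast
  next
    fix c :: "'v set \<Rightarrow> 'k"
    assume "c \<in> range (\<lambda>a. scale_chain a (elementary_chain {u, v}))"
    thus "c \<in> chains (Suc 0) ?K"
      using K by (auto simp: chains_def scale_chain_def elementary_chain_def split: if_splits)
  qed
  thus ?thesis
    by (simp add: boundaries_def image_image boundary_edge[OF assms] chain.span_singleton)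
qed

text \<open>The edge kills the difference of its two ends, a nonzero 0-chain in every characteristic,
  and so it leaves one essential class.\<close>

lemma essential_classes_edge:
  fixes u v :: "'v::linorder"
  assumes "u < v"
  shows "size (essential_part
    (power_complex_diagram TYPE('k::field) 0 {u, v} (edge_between u v))) = 1"
proof -
  let ?K = "power_complex {u, v} (edge_between u v)"
  let ?b = "elementary_chain {v} - elementary_chain {u} :: 'v set \<Rightarrow> 'k"
  have "?b {v} \<noteq> 0"
    using assms by (auto simp: elementary_chain_def)
  hence "?b \<noteq> 0" by (metis zero_fun_apply)
  hence "chain.dim (chain.span {?b}) = 1"
    using chain.dim_span_eq_card_independent[of "{?b}"] by simp
  moreover have "chain.span {?b} \<subseteq> chains 0 (?K i)" for i
    unfolding chains_0_power_complex
    by (auto simp: chain.span_singleton chains_def scale_chain_def elementary_chain_def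
      split: if_splits)
  ultimately have "persistent_betti TYPE('k) 0 (?K i) (?K 1) = 1" for i
    using assms unfolding persistent_betti_def quotient_dim_def boundaries_edge[OF assms] cycles_0
    by (simp add: Int_absorb1 dim_chains_0_power_complex)
  thus ?thesis
    using assms
    by (simp add: power_complex_diagram_def diameter_edge infinite_multiplicity_def
      size_essential_part_persistence_diagram pred_complex_def persistent_betti_empty)
qed

section \<open>Unboundedness\<close>

theorem theorem2:
  shows "\<not> (\<exists>\<alpha>::real. \<forall>(V::nat set) E1 E2 (p::nat).
    finite V \<and> V \<noteq> {} \<and> simple_graph V E1 \<and> simple_graph V E2 \<longrightarrow>
    bottleneck_distance
      (power_complex_diagram TYPE('k::field) p V E1)
      (power_complex_diagram TYPE('k) p V E2)
    \<le> ereal (\<alpha> * graph_distance V E1 E2))"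
proof -
  let ?V = "{0, 1 :: nat}" and ?E = "edge_between 0 (1 :: nat)"
  have "simple_graph ?V {}" "simple_graph ?V ?E"
    by (auto simp: simple_graph_def edge_between_def sym_def irrefl_def)
  moreover have "bottleneck_distance (power_complex_diagram TYPE('k) 0 ?V {})
      (power_complex_diagram TYPE('k) 0 ?V ?E) = \<infinity>"
    by (rule bottleneck_distance_infinite)
      (simp add: essential_classes_no_edges essential_classes_edge[of 0 "1::nat", simplified])
  ultimately have "\<not> bottleneck_distance (power_complex_diagram TYPE('k) 0 ?V {})
      (power_complex_diagram TYPE('k) 0 ?V ?E) \<le> ereal (\<alpha> * graph_distance ?V {} ?E)" for \<alpha>
    by simp
  thus ?thesis
    using \<open>simple_graph ?V {}\<close> \<open>simple_graph ?V ?E\<close>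
    by (meson finite.emptyI finite.insertI insert_not_empty)
qed

end
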